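(* Let $G$ and $H$ be graphs of orders $m\ge 2$ and $n\ge 2$, respectively, and let $G+H$ denote their join. Then $\gamma_{ds}(G+H)=2$ if and only if at least one of the following conditions holds: (1) $\gamma_{ds}(G)=2$ or $\gamma_{ds}(H)=2$; (2) $\Delta(G)=m-1$ and $\Delta(H)=n-1$.
   Context: All graphs are finite, simple and undirected; $\Delta(G)$ denotes the maximum degree of $G$, and the order of a graph is its number of vertices. A set $S\subseteq V(G)$ is a dual-server dominating set (DS-dominating set) of a graph $G$ if there is a partition $\{R,B\}$ of $S$ such that every vertex of $V(G)\setminus S$ has at least one neighbour in $R$ and at least one neighbour in $B$. The dual-server domination number $\gamma_{ds}(G)$ is the minimum cardinality of a DS-dominating set of $G$. The join $G+H$ is the graph obtained from the disjoint union $G\cup H$ by adding all edges joining every vertex of $G$ to every vertex of $H$. *)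

theory Defs
  imports "Graph_Theory.Graph_Theory" "HOL-Library.Disjoint_Sets"
begin

text \<open>
  A finite simple undirected graph is a \<open>pair_graph\<close>: a finite loop-free symmetric set of pairs
  over a finite vertex set, so that an edge \<open>{u, v}\<close> is represented by both \<open>(u, v)\<close> and \<open>(v, u)\<close>.
\<close>

text \<open>
  The condition \<open>R \<noteq> B\<close> is needed because \<open>{R, B}\<close> collapses to the one-block partition \<open>{S}\<close>
  for \<open>R = B = S\<close>. Blocks of a partition are nonempty.
\<close>

definition ds_dominating :: "'a pair_pre_digraph \<Rightarrow> 'a set \<Rightarrow> bool" where
  "ds_dominating G S \<longleftrightarrow> S \<subseteq> pverts G \<and>
     (\<exists>R B. R \<noteq> B \<and> partition_on S {R, B} \<and>
        (\<forall>v \<in> pverts G - S. (\<exists>r \<in> R. (v, r) \<in> parcs G) \<and> (\<exists>b \<in> B. (v, b) \<in> parcs G)))"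

text \<open>
  This is meaningful for graphs of order at least 2, where the whole vertex set is DS-dominating;
  smaller graphs have no vertex set that splits into two nonempty blocks.
\<close>

definition ds_domination_number :: "'a pair_pre_digraph \<Rightarrow> nat" (\<open>\<gamma>\<^sub>d\<^sub>s\<close>) where
  "\<gamma>\<^sub>d\<^sub>s G = (LEAST k. \<exists>S. ds_dominating G S \<and> card S = k)"

text \<open>By symmetry, the out-degree of a vertex is its number of neighbours.\<close>

definition max_degree :: "'a pair_pre_digraph \<Rightarrow> nat" (\<open>\<Delta>\<close>) where
  "\<Delta> G = Max (out_degree (with_proj G) ` pverts G)"

definition graph_join ::
    "'a pair_pre_digraph \<Rightarrow> 'b pair_pre_digraph \<Rightarrow> ('a + 'b) pair_pre_digraph"
    (infixl \<open>\<oplus>\<^sub>J\<close> 65) where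
  "G \<oplus>\<^sub>J H = \<lparr> pverts = pverts G <+> pverts H,
     parcs = {(Inl u, Inl v) | u v. (u, v) \<in> parcs G}
           \<union> {(Inr u, Inr v) | u v. (u, v) \<in> parcs H}
           \<union> {(Inl u, Inr v) | u v. u \<in> pverts G \<and> v \<in> pverts H}
           \<union> {(Inr v, Inl u) | u v. u \<in> pverts G \<and> v \<in> pverts H} \<rparr>"

lemma pair_graph_join:
  assumes "pair_graph G" "pair_graph H"
  shows "pair_graph (G \<oplus>\<^sub>J H)"
proof -
  interpret G: pair_graph G by fact
  interpret H: pair_graph H by fact
  have sub: "parcs (G \<oplus>\<^sub>J H) \<subseteq> pverts (G \<oplus>\<^sub>J H) \<times> pverts (G \<oplus>\<^sub>J H)"
    by (auto simp: graph_join_def dest: G.wellformed' H.wellformed')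
  have fin: "finite (pverts (G \<oplus>\<^sub>J H))"
    by (simp add: graph_join_def G.pair_finite_verts H.pair_finite_verts)
  have "finite (parcs (G \<oplus>\<^sub>J H))"
    using finite_subset[OF sub] fin by blast
  moreover have "symmetric (with_proj (G \<oplus>\<^sub>J H))"
    unfolding symmetric_def with_proj_simps
    by (rule symI) (auto simp: graph_join_def dest: G.arcs_symmetric H.arcs_symmetric)
  moreover have "fst e \<noteq> snd e" if "e \<in> parcs (G \<oplus>\<^sub>J H)" for e
    using that by (auto simp: graph_join_def dest: G.no_loops' H.no_loops')
  moreover have "fst e \<in> pverts (G \<oplus>\<^sub>J H)" "snd e \<in> pverts (G \<oplus>\<^sub>J H)"
    if "e \<in> parcs (G \<oplus>\<^sub>J H)" for e
    using that sub mem_Times_iff by blast+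
  ultimately show ?thesis
    using fin by unfold_locales
qed

lemma ds_dominating_pverts:
  assumes "2 \<le> card (pverts G)"
  shows "ds_dominating G (pverts G)"
proof -
  have "pverts G \<noteq> {}" using assms by auto
  then obtain u where u: "u \<in> pverts G" by blast
  have "pverts G \<noteq> {u}" using assms by auto
  then have ne: "pverts G - {u} \<noteq> {}" using u by blast
  have "partition_on (pverts G) {{u}, pverts G - {u}}"
  proof (rule partition_onI)
    show "\<Union>{{u}, pverts G - {u}} = pverts G" using u by blast
    show "{} \<notin> {{u}, pverts G - {u}}" using ne by blast
    show "disjnt p q" if "p \<in> {{u}, pverts G - {u}}" "q \<in> {{u}, pverts G - {u}}" "p \<noteq> q" for p q
      using that by (auto simp: disjnt_def)
  qed
  moreover have "{u} \<noteq> pverts G - {u}" by blast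
  ultimately show ?thesis
    unfolding ds_dominating_def by (intro conjI exI[of _ "{u}"] exI[of _ "pverts G - {u}"]) simp_all
qed

end

theory Submission
  imports Defs
begin

text \<open>
  A DS-dominating set has two disjoint nonempty blocks, so it has at least two elements, and one of
  size two is \<open>{x, y}\<close> with blocks \<open>{x}\<close> and \<open>{y}\<close>. Hence, for a graph \<open>G\<close> of order at least two,
  \<open>\<gamma>\<^sub>d\<^sub>s G = 2\<close> says that there are distinct
  vertices \<open>x\<close>, \<open>y\<close> such that every other vertex is adjacent to both (a serving pair). In a join
  \<open>G \<oplus>\<^sub>J H\<close>, two vertices of \<open>G\<close> are adjacent to all of \<open>H\<close>, so they form a serving pair of the join
  iff they form one of \<open>G\<close>; likewise for \<open>H\<close>. A vertex of \<open>G\<close> and a vertex of \<open>H\<close> form a serving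
  pair of the join iff each is adjacent to all other vertices of its own graph, and such a vertex
  exists iff the maximum degree is one less than the order.
\<close>

text \<open>Adjacency to both \<open>x\<close> and \<open>y\<close> is required of every vertex other than \<open>x\<close> and \<open>y\<close>.\<close>

definition serving_pair :: "'a pair_pre_digraph \<Rightarrow> 'a \<Rightarrow> 'a \<Rightarrow> bool" where
  "serving_pair G x y \<longleftrightarrow> x \<in> pverts G \<and> y \<in> pverts G \<and> x \<noteq> y \<and>
     (\<forall>v \<in> pverts G - {x, y}. (v, x) \<in> parcs G \<and> (v, y) \<in> parcs G)"

text \<open>A universal vertex is adjacent to all other vertices.\<close>

definition universal_vertex :: "'a pair_pre_digraph \<Rightarrow> 'a \<Rightarrow> bool" where
  "universal_vertex G x \<longleftrightarrow> x \<in> pverts G \<and> (\<forall>v \<in> pverts G - {x}. (v, x) \<in> parcs G)"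

lemma ds_dominating_obtain_blocks:
  assumes "ds_dominating G S"
  obtains R B where "S = R \<union> B" "R \<inter> B = {}" "R \<noteq> {}" "B \<noteq> {}" "S \<subseteq> pverts G"
    "\<And>v. v \<in> pverts G - S \<Longrightarrow> (\<exists>r \<in> R. (v, r) \<in> parcs G) \<and> (\<exists>b \<in> B. (v, b) \<in> parcs G)"
proof -
  obtain R B where RB: "R \<noteq> B" and part: "partition_on S {R, B}"
    and dom: "\<forall>v \<in> pverts G - S. (\<exists>r \<in> R. (v, r) \<in> parcs G) \<and> (\<exists>b \<in> B. (v, b) \<in> parcs G)"
    and sub: "S \<subseteq> pverts G"
    using assms unfolding ds_dominating_def by blast
  have "S = R \<union> B" "R \<noteq> {}" "B \<noteq> {}"
    using part by (auto simp: partition_on_def)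
  moreover have "R \<inter> B = {}"
    using partition_onD2[OF part] RB by (auto simp: disjoint_def)
  ultimately show thesis
    using that dom sub by blast
qed

lemma ds_dominating_card_ge_2:
  assumes "finite (pverts G)" "ds_dominating G S"
  shows "2 \<le> card S"
proof -
  obtain R B where S: "S = R \<union> B" "R \<inter> B = {}" "R \<noteq> {}" "B \<noteq> {}" "S \<subseteq> pverts G"
    using ds_dominating_obtain_blocks[OF assms(2)] by metis
  then have "finite R" "finite B"
    using assms(1) finite_subset by auto
  then have "card S = card R + card B" "0 < card R" "0 < card B"
    using S by (auto simp: card_Un_disjoint card_gt_0_iff)
  then show ?thesis
    by linarith
qed

lemma serving_pair_imp_ds_dominating:
  assumes "serving_pair G x y"
  shows "ds_dominating G {x, y}"
proof -
  have "partition_on {x, y} {{x}, {y}}"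
    by (auto simp: partition_on_def disjoint_def)
  then show ?thesis
    using assms unfolding ds_dominating_def serving_pair_def
    by (intro conjI exI[of _ "{x}"] exI[of _ "{y}"]) auto
qed

lemma ds_dominating_card_2_imp_serving_pair:
  assumes "finite (pverts G)" "ds_dominating G S" "card S = 2"
  shows "\<exists>x y. serving_pair G x y"
proof -
  obtain R B where S: "S = R \<union> B" "R \<inter> B = {}" "R \<noteq> {}" "B \<noteq> {}" "S \<subseteq> pverts G"
    and dom: "\<And>v. v \<in> pverts G - S \<Longrightarrow>
      (\<exists>r \<in> R. (v, r) \<in> parcs G) \<and> (\<exists>b \<in> B. (v, b) \<in> parcs G)"
    using ds_dominating_obtain_blocks[OF assms(2)] by metis
  have fin: "finite R" "finite B"
    using S assms(1) finite_subset by auto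
  then have "card R + card B = 2" "0 < card R" "0 < card B"
    using S assms(3) by (auto simp: card_Un_disjoint card_gt_0_iff)
  then have "card R = 1" "card B = 1"
    by linarith+
  then obtain x y where "R = {x}" "B = {y}"
    by (meson card_1_singletonE)
  then have "serving_pair G x y"
    using S dom unfolding serving_pair_def by auto
  then show ?thesis
    by blast
qed

lemma ds_domination_number_eq_2_iff:
  assumes "finite (pverts G)" "2 \<le> card (pverts G)"
  shows "\<gamma>\<^sub>d\<^sub>s G = 2 \<longleftrightarrow> (\<exists>x y. serving_pair G x y)"
proof
  assume two: "\<gamma>\<^sub>d\<^sub>s G = 2"
  \<comment> \<open>The minimum is attained because the whole vertex set is DS-dominating.\<close>
  have "\<exists>S. ds_dominating G S \<and> card S = \<gamma>\<^sub>d\<^sub>s G"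
    unfolding ds_domination_number_def
    by (rule LeastI_ex) (use ds_dominating_pverts[OF assms(2)] in blast)
  then show "\<exists>x y. serving_pair G x y"
    using two ds_dominating_card_2_imp_serving_pair[OF assms(1)] by metis
next
  assume "\<exists>x y. serving_pair G x y"
  then obtain x y where xy: "serving_pair G x y"
    by blast
  then have "card {x, y} = 2"
    by (simp add: serving_pair_def)
  then show "\<gamma>\<^sub>d\<^sub>s G = 2"
    unfolding ds_domination_number_def
    using serving_pair_imp_ds_dominating[OF xy] ds_dominating_card_ge_2[OF assms(1)]
    by (intro Least_equality) blast+
qed

lemma out_degree_eq_card_neighbours:
  "out_degree (with_proj G) x = card {v. (x, v) \<in> parcs G}"
proof -
  have "out_arcs (with_proj G) x = Pair x ` {v. (x, v) \<in> parcs G}"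
    by (auto simp: out_arcs_def)
  then show ?thesis
    by (simp add: out_degree_def card_image inj_on_def)
qed

text \<open>
  All neighbours of \<open>x\<close> lie in the vertex set without \<open>x\<close>, so full degree means equality of the
  two sets.
\<close>

lemma out_degree_le_and_eq_iff_universal:
  assumes "pair_graph G" "x \<in> pverts G"
  shows "out_degree (with_proj G) x \<le> card (pverts G) - 1"
    and "out_degree (with_proj G) x = card (pverts G) - 1 \<longleftrightarrow> universal_vertex G x"
proof -
  interpret pair_graph G by fact
  let ?N = "{v. (x, v) \<in> parcs G}"
  have sub: "?N \<subseteq> pverts G - {x}"
    by (auto dest: wellformed' no_loops')
  have card: "card (pverts G - {x}) = card (pverts G) - 1"
    using assms(2) by simp
  have fin: "finite (pverts G - {x})"
    by simp
  show "out_degree (with_proj G) x \<le> card (pverts G) - 1"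
    using card_mono[OF fin sub] card by (simp add: out_degree_eq_card_neighbours)
  have "card ?N = card (pverts G - {x}) \<longleftrightarrow> ?N = pverts G - {x}"
    using card_subset_eq[OF fin sub] by metis
  also have "\<dots> \<longleftrightarrow> universal_vertex G x"
    using sub assms(2) unfolding universal_vertex_def by (auto dest: arcs_symmetric)
  finally show "out_degree (with_proj G) x = card (pverts G) - 1 \<longleftrightarrow> universal_vertex G x"
    using card by (simp add: out_degree_eq_card_neighbours)
qed

lemma max_degree_eq_iff_universal:
  assumes "pair_graph G" "pverts G \<noteq> {}"
  shows "\<Delta> G = card (pverts G) - 1 \<longleftrightarrow> (\<exists>x. universal_vertex G x)"
proof -
  interpret pair_graph G by fact
  let ?D = "out_degree (with_proj G) ` pverts G"
  have "\<Delta> G = card (pverts G) - 1 \<longleftrightarrow> card (pverts G) - 1 \<in> ?D"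
    unfolding max_degree_def
    using Max_eq_iff[of ?D "card (pverts G) - 1"] assms(2)
      out_degree_le_and_eq_iff_universal(1)[OF assms(1)]
    by auto
  also have "\<dots> \<longleftrightarrow> (\<exists>x. universal_vertex G x)"
    using out_degree_le_and_eq_iff_universal(2)[OF assms(1)]
    by (metis (no_types, lifting) image_iff universal_vertex_def)
  finally show ?thesis .
qed

lemma pverts_graph_join [simp]: "pverts (G \<oplus>\<^sub>J H) = pverts G <+> pverts H"
  by (simp add: graph_join_def)

lemma parcs_graph_join_iff [simp]:
  "(Inl u, Inl v) \<in> parcs (G \<oplus>\<^sub>J H) \<longleftrightarrow> (u, v) \<in> parcs G"
  "(Inr w, Inr z) \<in> parcs (G \<oplus>\<^sub>J H) \<longleftrightarrow> (w, z) \<in> parcs H"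
  "(Inl u, Inr w) \<in> parcs (G \<oplus>\<^sub>J H) \<longleftrightarrow> u \<in> pverts G \<and> w \<in> pverts H"
  "(Inr w, Inl u) \<in> parcs (G \<oplus>\<^sub>J H) \<longleftrightarrow> u \<in> pverts G \<and> w \<in> pverts H"
  by (auto simp: graph_join_def)

lemma serving_pair_commute: "serving_pair G x y \<longleftrightarrow> serving_pair G y x"
  unfolding serving_pair_def by (auto simp: insert_commute)

lemma ball_Plus_diff_iff:
  "(\<forall>v \<in> (A <+> B) - C. P v) \<longleftrightarrow>
    (\<forall>a \<in> A. Inl a \<notin> C \<longrightarrow> P (Inl a)) \<and> (\<forall>b \<in> B. Inr b \<notin> C \<longrightarrow> P (Inr b))"
  by (auto simp: Plus_def)

lemma serving_pair_join_Inl_Inl: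
  "serving_pair (G \<oplus>\<^sub>J H) (Inl x) (Inl y) \<longleftrightarrow> serving_pair G x y"
  unfolding serving_pair_def by (auto simp: ball_Plus_diff_iff)

lemma serving_pair_join_Inr_Inr:
  "serving_pair (G \<oplus>\<^sub>J H) (Inr x) (Inr y) \<longleftrightarrow> serving_pair H x y"
  unfolding serving_pair_def by (auto simp: ball_Plus_diff_iff)

lemma serving_pair_join_Inl_Inr:
  "serving_pair (G \<oplus>\<^sub>J H) (Inl x) (Inr y) \<longleftrightarrow> universal_vertex G x \<and> universal_vertex H y"
  unfolding serving_pair_def universal_vertex_def by (auto simp: ball_Plus_diff_iff)

lemma ex_serving_pair_join_iff:
  "(\<exists>p q. serving_pair (G \<oplus>\<^sub>J H) p q) \<longleftrightarrow>
    (\<exists>x y. serving_pair G x y) \<or> (\<exists>x y. serving_pair H x y) \<or>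
    (\<exists>x. universal_vertex G x) \<and> (\<exists>y. universal_vertex H y)"
  (is "?L \<longleftrightarrow> ?R")
proof
  assume ?L
  then obtain p q where pq: "serving_pair (G \<oplus>\<^sub>J H) p q"
    by blast
  then have qp: "serving_pair (G \<oplus>\<^sub>J H) q p"
    using serving_pair_commute by metis
  show ?R
    using pq qp
    by (cases p; cases q)
      (auto simp: serving_pair_join_Inl_Inl serving_pair_join_Inr_Inr serving_pair_join_Inl_Inr)
next
  assume ?R
  then show ?L
    by (metis serving_pair_join_Inl_Inl serving_pair_join_Inr_Inr serving_pair_join_Inl_Inr)
qed

theorem theorem3p1:
  fixes G :: "'a pair_pre_digraph" and H :: "'b pair_pre_digraph" and m n :: nat
  assumes "pair_graph G" and "pair_graph H"
    and "card (pverts G) = m" and "card (pverts H) = n"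
    and "m \<ge> 2" and "n \<ge> 2"
  shows "\<gamma>\<^sub>d\<^sub>s (G \<oplus>\<^sub>J H) = 2 \<longleftrightarrow>
    (\<gamma>\<^sub>d\<^sub>s G = 2 \<or> \<gamma>\<^sub>d\<^sub>s H = 2) \<or>
    (\<Delta> G = m - 1 \<and> \<Delta> H = n - 1)"
proof -
  have finG: "finite (pverts G)" and finH: "finite (pverts H)"
    using assms(3-6) by (auto intro: card_ge_0_finite)
  have neG: "pverts G \<noteq> {}" and neH: "pverts H \<noteq> {}"
    using assms(3-6) by auto
  have finJ: "finite (pverts (G \<oplus>\<^sub>J H))"
    using finG finH by simp
  have cardJ: "2 \<le> card (pverts (G \<oplus>\<^sub>J H))"
    using finG finH assms(3-6) by (simp add: card_Plus)
  have "\<gamma>\<^sub>d\<^sub>s (G \<oplus>\<^sub>J H) = 2 \<longleftrightarrow> (\<exists>p q. serving_pair (G \<oplus>\<^sub>J H) p q)"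
    using ds_domination_number_eq_2_iff[OF finJ cardJ] .
  moreover have "\<gamma>\<^sub>d\<^sub>s G = 2 \<longleftrightarrow> (\<exists>x y. serving_pair G x y)"
    using ds_domination_number_eq_2_iff[OF finG] assms(3,5) by simp
  moreover have "\<gamma>\<^sub>d\<^sub>s H = 2 \<longleftrightarrow> (\<exists>x y. serving_pair H x y)"
    using ds_domination_number_eq_2_iff[OF finH] assms(4,6) by simp
  moreover have "\<Delta> G = m - 1 \<longleftrightarrow> (\<exists>x. universal_vertex G x)"
    using max_degree_eq_iff_universal[OF assms(1) neG] assms(3) by simp
  moreover have "\<Delta> H = n - 1 \<longleftrightarrow> (\<exists>y. universal_vertex H y)"
    using max_degree_eq_iff_universal[OF assms(2) neH] assms(4) by simp
  ultimately show ?thesis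
    using ex_serving_pair_join_iff[of G H] by simp
qed

end
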